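(* The following are equivalent for a function $F : \mathbb{R} \to \mathbb{R}$. (1) Applied entrywise, $F$ maps $\mathcal{M}([-1,0])$ into $\mathcal{M}((-\infty,0])$. (2) There exists an absolutely monotonic entire function $\widetilde{F}$ such that \[ F(x) = \begin{cases} \widetilde{F}(x) & \text{if } x \in (0,\infty),\\ 0 & \text{if } x=0,\\ -\widetilde{F}(-x) & \text{if } x \in (-\infty,0). \end{cases} \]
   Context: An admissible measure is a non-negative measure $\mu$ on $\mathbb{R}$ possessing moments of all orders; its moments are $s_k(\mu) := \int_{\mathbb{R}} x^k \, d\mu$ ($k \geq 0$), where $s_0(\mu)$ is the total mass. For $K \subset \mathbb{R}$, $\mathcal{M}(K)$ denotes the set of moment sequences $(s_k(\mu))_{k \geq 0}$ of admissible measures $\mu$ supported on $K$. A function $F$ acts entrywise on a sequence by $F[(s_k)_{k\geq 0}] := (F(s_k))_{k \geq 0}$. An absolutely monotonic entire function is an entire function all of whose Taylor coefficients at $0$ are non-negative. *)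

theory Defs
  imports "HOL-Complex_Analysis.Complex_Analysis"
begin

definition admissible_measure :: "real measure \<Rightarrow> bool" where
  "admissible_measure \<mu> \<longleftrightarrow>
     sets \<mu> = sets borel \<and> (\<forall>k. integrable \<mu> (\<lambda>x. x ^ k))"

(* Since 0 ^ 0 = 1, moment \<mu> 0 is the total mass. *)
definition moment :: "real measure \<Rightarrow> nat \<Rightarrow> real" where
  "moment \<mu> k = (\<integral>x. x ^ k \<partial>\<mu>)"

(* For Borel K the condition AE x in \<mu>. x \<in> K says that \<mu> vanishes on the complement
   of K; for closed K this is the same as: the topological support of \<mu> lies in K. *)
definition moment_sequences :: "real set \<Rightarrow> (nat \<Rightarrow> real) set" where
  "moment_sequences K =
     {moment \<mu> | \<mu>. admissible_measure \<mu> \<and> (AE x in \<mu>. x \<in> K)}"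

definition entrywise :: "(real \<Rightarrow> real) \<Rightarrow> (nat \<Rightarrow> real) \<Rightarrow> nat \<Rightarrow> real" where
  "entrywise F s = (\<lambda>k. F (s k))"

definition absolutely_monotonic_entire :: "(complex \<Rightarrow> complex) \<Rightarrow> bool" where
  "absolutely_monotonic_entire f \<longleftrightarrow>
     f holomorphic_on UNIV \<and> (\<forall>n. (deriv ^^ n) f 0 / fact n \<in> \<real>\<^sub>\<ge>\<^sub>0)"

end

theory Submission
  imports Defs "HOL-Probability.Probability"
begin

text \<open>Write \<open>t\<^sub>k = (-1)\<^sup>k s\<^sub>k\<close> for the moments of the reflected measure, which lives on \<open>[0, 1]\<close>.

Sufficiency. If \<open>G(z) = \<Sum>c\<^sub>n z\<^sup>n\<close> with \<open>c\<^sub>n \<ge> 0\<close>, then \<open>t\<^sub>k\<^sup>n\<close> is the \<open>k\<close>-th moment of the \<open>n\<close>-fold multiplicative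
convolution power of the reflected measure, so \<open>G(t\<^sub>k)\<close> is the \<open>k\<close>-th moment of an infinite sum of
such powers with non-negative weights; the odd extension \<open>F\<close> puts the signs \<open>(-1)\<^sup>k\<close> back (\<open>power_series_of_abs_moments\<close>). Only
multiples of the Dirac measure at 0, whose moments \<open>t\<^sub>k\<close> with \<open>k > 0\<close> vanish, need a separate look, because
\<open>F 0 = 0\<close> may differ from \<open>c\<^sub>0\<close>.

Necessity uses nothing but two-atom measures, with \<open>t\<^sub>k = a + b u\<^sup>k\<close>. The test polynomials \<open>1\<close>,
\<open>x\<close>, \<open>(1 - x)\<^sup>2\<close> and \<open>x (1 - x)\<^sup>2\<close> show that \<open>F\<close> vanishes at 0, is odd, and increases on \<open>[0, \<infinity>)\<close>.
Hence \<open>F(t\<^sub>k)\<close> is bounded in \<open>k\<close>, the representing measure lives on \<open>[0, 1]\<close>, and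
\<open>\<Sum>p\<^sub>k F(a + b u\<^sup>k) \<ge> 0\<close> for each polynomial \<open>p = \<Sum>p\<^sub>k x\<^sup>k\<close> that is non-negative on \<open>[0, 1]\<close>
(\<open>preserver_geometric_moments\<close>). These inequalities are exploited in three steps.

\<^item> Smoothness. For \<open>a = 0\<close> they say that \<open>s \<mapsto> F(e\<^sup>-\<^sup>s)\<close> is completely monotone, in a form that
  presupposes no regularity. Such a function is convex, and its negated derivative exists and is
  again of this kind (\<open>completely_monotone_derivative\<close>), so \<open>F\<close> is smooth on \<open>(0, \<infinity>)\<close>.
\<^item> Signs. For \<open>p = \<Prod>\<^sub>j\<^sub><\<^sub>n (x - u\<^sup>j)\<^sup>2\<close> the functional kills \<open>(u\<^sup>k)\<^sup>j\<close> for \<open>j < n\<close>, so as \<open>b\<close> tends to 0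
  the leading term of the Taylor expansion at \<open>a\<close> is a positive multiple of the \<open>n\<close>-th derivative
  \<open>F\<^sup>(\<^sup>n\<^sup>)(a)\<close> (\<open>derivative_nonneg_if_geometric_moments\<close>).
\<^item> Analyticity. A smooth function on \<open>(0, \<infinity>)\<close> whose derivatives are all non-negative is the
  restriction of an absolutely monotonic entire function, by a theorem of Bernstein
  (\<open>absolutely_monotonic_entire_if_derivatives_nonneg\<close>).\<close>

section \<open>The functional of a sequence on polynomials\<close>

text \<open>The Riesz functional of the sequence \<open>m\<close>: it maps \<open>x\<^sup>k\<close> to \<open>m k\<close>. If \<open>m\<close> is the moment sequence
of a measure, it is integration against that measure.\<close>

definition moment_functional :: "real poly \<Rightarrow> (nat \<Rightarrow> real) \<Rightarrow> real" where
  "moment_functional p m = (\<Sum>k\<le>degree p. coeff p k * m k)"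

definition nonneg_on_unit :: "real poly \<Rightarrow> bool" where
  "nonneg_on_unit p \<longleftrightarrow> (\<forall>x\<in>{0..1}. 0 \<le> poly p x)"

lemma moment_functional_altdef:
  "degree p \<le> N \<Longrightarrow> moment_functional p m = (\<Sum>k\<le>N. coeff p k * m k)"
  unfolding moment_functional_def
  by (rule sum.mono_neutral_left) (auto simp: coeff_eq_0)

lemma moment_functional_add:
  "moment_functional (p + q) m = moment_functional p m + moment_functional q m"
proof -
  define N where "N = max (degree p) (degree q)"
  have "degree (p + q) \<le> N" "degree p \<le> N" "degree q \<le> N"
    by (auto simp: N_def degree_add_le)
  then show ?thesis
    by (simp add: moment_functional_altdef[of _ N] sum.distrib algebra_simps)
qed

lemma moment_functional_pCons:
  "moment_functional (pCons c p) m = c * m 0 + moment_functional p (\<lambda>k. m (Suc k))"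
proof -
  have "degree (pCons c p) \<le> Suc (degree p)" by (rule degree_pCons_le)
  then show ?thesis
    by (simp only: moment_functional_altdef[of _ "Suc (degree p)"] moment_functional_def[of p]
        sum.atMost_Suc_shift coeff_pCons_0 coeff_pCons_Suc)
qed

lemma moment_functional_0 [simp]: "moment_functional 0 m = 0"
  by (simp add: moment_functional_def)

lemma moment_functional_smult: "moment_functional (smult c p) m = c * moment_functional p m"
  by (induction p arbitrary: m)
     (simp_all add: moment_functional_pCons algebra_simps)

lemma moment_functional_linear:
  "moment_functional p (\<lambda>k. a * m k + b * m' k) = a * moment_functional p m + b * moment_functional p m'"
  unfolding moment_functional_def sum_distrib_left sum.distrib [symmetric]
  by (intro sum.cong refl) (simp add: algebra_simps)

lemma moment_functional_mult_monom:
  "moment_functional (monom 1 n * p) m = moment_functional p (\<lambda>k. m (k + n))"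
  by (induction n arbitrary: m) (simp_all add: monom_Suc monom_0 moment_functional_pCons)

text \<open>Substituting \<open>x\<^sup>n\<close> for \<open>x\<close> samples the sequence at multiples of \<open>n\<close>. Together with the next lemma
this turns test polynomials on a fine grid into test polynomials for difference quotients on a
coarse grid.\<close>

lemma moment_functional_pcompose_monom:
  "moment_functional (pcompose p (monom 1 n)) m = moment_functional p (\<lambda>k. m (k * n))"
proof (induction p arbitrary: m)
  case (pCons c p)
  show ?case
    by (simp add: pcompose_pCons moment_functional_add moment_functional_pCons
        moment_functional_mult_monom pCons.IH algebra_simps)
qed simp

lemma moment_functional_mult_one_minus:
  "moment_functional (p * [:1, -1:]) m = moment_functional p (\<lambda>k. m k - m (Suc k))"
proof -
  have "p * [:1, -1:] = p + smult (-1) (monom 1 1 * p)"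
    by (simp add: monom_altdef algebra_simps)
  then have "moment_functional (p * [:1, -1:]) m
      = moment_functional p m - moment_functional p (\<lambda>k. m (Suc k))"
    by (simp only: moment_functional_add moment_functional_smult moment_functional_mult_monom) simp
  also have "\<dots> = moment_functional p (\<lambda>k. 1 * m k + (-1) * m (Suc k))"
    by (subst moment_functional_linear) simp
  finally show ?thesis by simp
qed

lemma tendsto_moment_functional:
  assumes "\<And>k. ((\<lambda>n. f n k) \<longlongrightarrow> l k) F"
  shows "((\<lambda>n. moment_functional p (f n)) \<longlongrightarrow> moment_functional p l) F"
  unfolding moment_functional_def by (intro tendsto_sum tendsto_mult tendsto_const assms)

lemma moment_functional_monom: "moment_functional (monom 1 n) m = m n"
  using moment_functional_mult_monom[of n 1] by (simp add: moment_functional_def)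

section \<open>Completely monotone functions are smooth\<close>

text \<open>On every arithmetic progression the values of \<open>g\<close> pass the Hausdorff test for being moments of a
measure on \<open>[0, 1]\<close>. The polynomials \<open>(1 - x)\<^sup>n\<close> give the classical condition on alternating
differences; admitting all non-negative polynomials makes the passage to the derivative a
substitution in the polynomial.\<close>

definition completely_monotone :: "(real \<Rightarrow> real) \<Rightarrow> bool" where
  "completely_monotone g \<longleftrightarrow>
     (\<forall>p s \<delta>. nonneg_on_unit p \<longrightarrow> \<delta> > 0 \<longrightarrow> 0 \<le> moment_functional p (\<lambda>k. g (s + real k * \<delta>)))"

lemma completely_monotoneD:
  "completely_monotone g \<Longrightarrow> nonneg_on_unit p \<Longrightarrow> \<delta> > 0 \<Longrightarrow>
     0 \<le> moment_functional p (\<lambda>k. g (s + real k * \<delta>))"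
  by (simp add: completely_monotone_def)

lemma completely_monotone_antimono:
  assumes "completely_monotone g" "x \<le> y"
  shows "g y \<le> g x"
proof (cases "x = y")
  case False
  have "nonneg_on_unit [:1, -1:]" by (simp add: nonneg_on_unit_def)
  from completely_monotoneD[OF assms(1) this, of "y - x" x] False assms(2)
  show ?thesis by (simp add: moment_functional_pCons)
qed simp

text \<open>The weighted inequality of arithmetic and geometric means for \<open>1\<close> and \<open>x\<^sup>n\<close>. It provides the test
polynomial that compares a point of a grid with the chord over the whole grid.\<close>

lemma chord_poly_nonneg:
  fixes x :: real
  assumes "0 \<le> x" "x \<le> 1" and "k \<le> n"
  shows "real n * x ^ k \<le> (real n - real k) + real k * x ^ n"
  using assms(3)
proof (induction n rule: dec_induct)
  case (step n)
  have "real k * x ^ n \<le> (\<Sum>i<k. x ^ i)"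
    using sum_mono[of "{..<k}" "\<lambda>_. x ^ n" "\<lambda>i. x ^ i"] assms step.hyps
    by (simp add: power_decreasing)
  then have "(1 - x) * (real k * x ^ n) \<le> (1 - x) * (\<Sum>i<k. x ^ i)"
    using assms by (intro mult_left_mono) auto
  also have "\<dots> = 1 - x ^ k" by (simp add: one_diff_power_eq)
  finally show ?case using step.IH by (simp add: algebra_simps)
qed simp

lemma completely_monotone_chord:
  assumes g: "completely_monotone g" and "k \<le> n" "n > 0" "x < y"
  shows "g (x + real k / real n * (y - x)) \<le> (1 - real k / real n) * g x + real k / real n * g y"
proof -
  define p where "p = [:real n - real k:] + smult (real k) (monom 1 n) + smult (- real n) (monom 1 k)"
  have "nonneg_on_unit p"
    using chord_poly_nonneg[OF _ _ \<open>k \<le> n\<close>]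
    by (auto simp: nonneg_on_unit_def p_def poly_monom)
  moreover have "(y - x) / real n > 0" using assms by simp
  ultimately have "0 \<le> moment_functional p (\<lambda>i. g (x + real i * ((y - x) / real n)))"
    by (rule completely_monotoneD[OF g])
  also have "\<dots> = (real n - real k) * g x + real k * g y
       - real n * g (x + real k / real n * (y - x))"
    unfolding p_def moment_functional_add moment_functional_smult moment_functional_monom
    using \<open>n > 0\<close> by (simp add: moment_functional_pCons)
  finally show ?thesis using \<open>n > 0\<close> by (simp add: field_simps)
qed

text \<open>Grids of \<open>n\<close> equal steps give convexity for rational weights. As \<open>g\<close> is decreasing, a real weight can
be approached by rational weights from below without knowing that \<open>g\<close> is continuous.\<close>

lemma completely_monotone_convex:
  assumes g: "completely_monotone g"
  shows "convex_on UNIV g"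
proof -
  have *: "g (x + t * (y - x)) \<le> (1 - t) * g x + t * g y"
    if "x < y" "0 < t" "t < 1" for x y t
  proof (rule tendsto_lowerbound)
    define r where "r n = real (nat \<lfloor>real n * t\<rfloor>) / real n" for n
    have r_le: "r n \<le> t" and r_ge: "t - 1 / real n \<le> r n" if "n > 0" for n
    proof -
      have "real (nat \<lfloor>real n * t\<rfloor>) = real_of_int \<lfloor>real n * t\<rfloor>"
        using \<open>0 < t\<close> by simp
      then have "real (nat \<lfloor>real n * t\<rfloor>) \<le> real n * t" "real n * t - 1 \<le> real (nat \<lfloor>real n * t\<rfloor>)"
        by linarith+
      then have "r n \<le> (real n * t) / real n" "(real n * t - 1) / real n \<le> r n"
        unfolding r_def by (intro divide_right_mono; simp)+
      then show "r n \<le> t" "t - 1 / real n \<le> r n"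
        using that by (simp_all add: diff_divide_distrib)
    qed
    have "r \<longlonglongrightarrow> t"
    proof (rule tendsto_sandwich)
      show "(\<lambda>n. t - 1 / real n) \<longlonglongrightarrow> t"
        by (rule tendsto_eq_intros lim_1_over_n refl)+ simp
      show "\<forall>\<^sub>F n in sequentially. t - 1 / real n \<le> r n" "\<forall>\<^sub>F n in sequentially. r n \<le> t"
        by (rule eventually_mono[OF eventually_gt_at_top[of 0]]; fact r_le r_ge)+
    qed auto
    then show "(\<lambda>n. (1 - r n) * g x + r n * g y) \<longlonglongrightarrow> (1 - t) * g x + t * g y"
      by (intro tendsto_intros)
    have le: "g (x + t * (y - x)) \<le> (1 - r n) * g x + r n * g y" if "n > 0" for n
    proof -
      have "real n * t \<le> real n" using \<open>t < 1\<close> by (simp add: mult_left_le)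
      then have "nat \<lfloor>real n * t\<rfloor> \<le> n" by linarith
      have "g (x + t * (y - x)) \<le> g (x + r n * (y - x))"
        using r_le[OF that] \<open>x < y\<close>
        by (intro completely_monotone_antimono[OF g]) (simp add: mult_right_mono)
      also have "\<dots> \<le> (1 - r n) * g x + r n * g y"
        unfolding r_def using g \<open>nat \<lfloor>real n * t\<rfloor> \<le> n\<close> that \<open>x < y\<close>
        by (rule completely_monotone_chord)
      finally show ?thesis .
    qed
    show "\<forall>\<^sub>F n in sequentially. g (x + t * (y - x)) \<le> (1 - r n) * g x + r n * g y"
      by (rule eventually_mono[OF eventually_gt_at_top[of 0]]) (rule le)
  qed auto
  have "g ((1 - t) *\<^sub>R x + t *\<^sub>R y) \<le> (1 - t) * g x + t * g y" if "0 < t" "t < 1" for t x y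
    using *[of x y t] *[of y x "1 - t"] that
    by (cases x y rule: linorder_cases) (auto simp: algebra_simps)
  then show ?thesis by (intro convex_onI) auto
qed

text \<open>Convexity makes the quotients \<open>(g s - g (s + h)) / h\<close> increase to a limit \<open>A s\<close> as \<open>h\<close> decreases to 0.
On the grid of step \<open>\<delta> / n\<close> the polynomial \<open>p(x\<^sup>n) (1 - x)\<close> tests the quotient with \<open>h = \<delta> / n\<close> on the
grid of step \<open>\<delta>\<close>, so \<open>A\<close> is completely monotone, hence convex, hence continuous. The quotient with
step \<open>h\<close> lies between \<open>A (s + h)\<close> and \<open>A s\<close>, so the one-sided derivative is a derivative.\<close>

lemma completely_monotone_derivative:
  assumes g: "completely_monotone g"
  shows "\<exists>A. completely_monotone A \<and> (\<forall>s. (g has_real_derivative - A s) (at s))"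
proof -
  define q where "q s h = (g s - g (s + h)) / h" for s h
  define A where "A s = (SUP h\<in>{0<..}. q s h)" for s
  have slope1: "(g x - g t) / (x - t) \<le> (g x - g y) / (x - y)"
   and slope2: "(g x - g y) / (x - y) \<le> (g t - g y) / (t - y)"
   if "x < t" "t < y" for x t y
    using convex_on_slope_le[OF completely_monotone_convex[OF g] UNIV_I UNIV_I that] .
  have q_slope: "q x (y - x) = - ((g x - g y) / (x - y))" if "x < y" for x y
    using that by (simp add: q_def field_simps)
  \<comment> \<open>The quotients increase as the step shrinks and are bounded by the slope to the left.\<close>
  have q_anti: "q s h' \<le> q s h" if "0 < h" "h \<le> h'" for s h h'
    using slope1[of s "s + h" "s + h'"] q_slope[of s "s + h"] q_slope[of s "s + h'"] that
    by (cases "h = h'") auto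
  have q_left: "q y (z - y) \<le> q x (y - x)" if "x < y" "y < z" for x y z
    using slope1[OF that] slope2[OF that] q_slope[of x y] q_slope[of y z] that by auto
  have bdd: "bdd_above (q s ` {0<..})" for s
  proof (rule bdd_aboveI2)
    fix h :: real assume "h \<in> {0<..}"
    then show "q s h \<le> q (s - 1) 1" using q_left[of "s - 1" s "s + h"] by simp
  qed
  have q_le_A: "q s h \<le> A s" if "0 < h" for s h
    unfolding A_def using that by (intro cSUP_upper bdd) auto
  have A_le_q: "A y \<le> q x (y - x)" if "x < y" for x y
    unfolding A_def
  proof (rule cSUP_least)
    fix h :: real assume "h \<in> {0<..}"
    then show "q y h \<le> q x (y - x)" using q_left[OF that, of "y + h"] by simp
  qed simp
  have q_lim: "(\<lambda>m. q s (\<delta> / real (Suc m))) \<longlonglongrightarrow> A s" if "0 < \<delta>" for s \<delta>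
  proof (rule increasing_tendsto)
    show "\<forall>\<^sub>F m in sequentially. q s (\<delta> / real (Suc m)) \<le> A s"
      using that by (intro always_eventually allI q_le_A) simp
    fix x assume "x < A s"
    then obtain h where h: "h > 0" "x < q s h"
      unfolding A_def using less_cSUP_iff[OF _ bdd] by auto
    have "(\<lambda>m. \<delta> / real (Suc m)) \<longlonglongrightarrow> 0"
      using LIMSEQ_Suc[OF lim_const_over_n[of \<delta>]] by simp
    then have "\<forall>\<^sub>F m in sequentially. \<delta> / real (Suc m) < h"
      using h(1) by (rule order_tendstoD)
    then show "\<forall>\<^sub>F m in sequentially. x < q s (\<delta> / real (Suc m))"
    proof eventually_elim
      case (elim m)
      then have "q s h \<le> q s (\<delta> / real (Suc m))" using that by (intro q_anti) auto
      with h(2) show ?case by simp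
    qed
  qed
  have A: "completely_monotone A"
    unfolding completely_monotone_def
  proof (intro allI impI)
    fix p s and \<delta> :: real assume p: "nonneg_on_unit p" and "\<delta> > 0"
    have "0 \<le> moment_functional p (\<lambda>k. q (s + real k * \<delta>) (\<delta> / real (Suc m)))" for m
    proof -
      \<comment> \<open>Refine the grid so that the step of the quotient becomes one step of the grid.\<close>
      define n where "n = Suc m"
      define \<epsilon> where "\<epsilon> = \<delta> / real n"
      have "\<epsilon> > 0" and n\<epsilon>: "real n * \<epsilon> = \<delta>" using \<open>\<delta> > 0\<close> by (simp_all add: \<epsilon>_def n_def)
      define r where "r = pcompose p (monom 1 n) * [:1, -1:]"
      have "nonneg_on_unit r"
        using p by (auto simp: nonneg_on_unit_def r_def poly_pcompose poly_monom power_le_one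
            intro!: mult_left_le_one_le)
      then have "0 \<le> moment_functional r (\<lambda>k. g (s + real k * \<epsilon>))"
        using g \<open>\<epsilon> > 0\<close> by (intro completely_monotoneD)
      also have "\<dots> = moment_functional p (\<lambda>k. g (s + real (k * n) * \<epsilon>) - g (s + real (Suc (k * n)) * \<epsilon>))"
        unfolding r_def moment_functional_mult_one_minus moment_functional_pcompose_monom by simp
      also have "\<dots> = moment_functional p (\<lambda>k. \<epsilon> * q (s + real k * \<delta>) \<epsilon> + 0 * 0)"
        using \<open>\<epsilon> > 0\<close> by (simp add: q_def flip: n\<epsilon>) (simp add: algebra_simps)
      also have "\<dots> = \<epsilon> * moment_functional p (\<lambda>k. q (s + real k * \<delta>) \<epsilon>)"
        by (subst moment_functional_linear) simp
      finally have "0 \<le> moment_functional p (\<lambda>k. q (s + real k * \<delta>) \<epsilon>)"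
        using \<open>\<epsilon> > 0\<close> by (simp add: zero_le_mult_iff)
      then show ?thesis by (simp add: \<epsilon>_def n_def)
    qed
    then show "0 \<le> moment_functional p (\<lambda>k. A (s + real k * \<delta>))"
      by (intro tendsto_lowerbound[OF tendsto_moment_functional[OF q_lim[OF \<open>\<delta> > 0\<close>]]] always_eventually allI) auto
  qed
  have A_cont: "isCont A s" for s
    using convex_on_continuous[OF open_UNIV completely_monotone_convex[OF A]]
    by (simp add: continuous_on_eq_continuous_at)
  have "(g has_real_derivative - A s) (at s)" for s
  proof -
    have A_shift: "((\<lambda>h. A (s + h)) \<longlongrightarrow> A s) (at 0)"
      using A_cont[of s] by (simp add: isCont_def LIM_offset_zero)
    have "((\<lambda>h. (g (s + h) - g s) / h) \<longlongrightarrow> - A s) (at 0)"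
    proof (rule tendsto_sandwich)
      have ge: "- max (A s) (A (s + h)) \<le> (g (s + h) - g s) / h"
       and le: "(g (s + h) - g s) / h \<le> - min (A s) (A (s + h))" if "h \<noteq> 0" for h
      proof -
        have "(g (s + h) - g s) / h = - q (min s (s + h)) \<bar>h\<bar>"
          using that by (cases "h > 0") (auto simp: q_def min_def field_simps)
        moreover have "q (min s (s + h)) \<bar>h\<bar> \<le> A (min s (s + h))"
          using that by (intro q_le_A) simp
        moreover have "A (max s (s + h)) \<le> q (min s (s + h)) \<bar>h\<bar>"
          using A_le_q[of "min s (s + h)" "max s (s + h)"] that
          by (cases "h > 0") (auto simp: min_def max_def)
        ultimately show "- max (A s) (A (s + h)) \<le> (g (s + h) - g s) / h"
           "(g (s + h) - g s) / h \<le> - min (A s) (A (s + h))"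
          by (cases "h > 0"; auto simp: min_def max_def)+
      qed
      show "\<forall>\<^sub>F h in at 0. - max (A s) (A (s + h)) \<le> (g (s + h) - g s) / h"
        "\<forall>\<^sub>F h in at 0. (g (s + h) - g s) / h \<le> - min (A s) (A (s + h))"
        using ge le by (auto simp: eventually_at_filter)
      show "((\<lambda>h. - max (A s) (A (s + h))) \<longlongrightarrow> - A s) (at 0)"
        using tendsto_minus[OF tendsto_max[OF tendsto_const A_shift, of "A s"]] by simp
      show "((\<lambda>h. - min (A s) (A (s + h))) \<longlongrightarrow> - A s) (at 0)"
        using tendsto_minus[OF tendsto_min[OF tendsto_const A_shift, of "A s"]] by simp
    qed
    then show ?thesis by (simp add: DERIV_def)
  qed
  with A show ?thesis by blast
qed

text \<open>A class that contains \<open>x \<mapsto> g (- ln x)\<close> for each completely monotone \<open>g\<close> and is closed under differentiation on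
\<open>(0, \<infinity>)\<close>: the chain rule produces a factor \<open>1 / x\<close>, and the quotient rule a difference. Iterated
derivatives exist without a formula for them.\<close>

inductive_set log_smooth :: "(real \<Rightarrow> real) set" where
  comp_ln: "completely_monotone g \<Longrightarrow> (\<lambda>x. g (- ln x)) \<in> log_smooth"
| over_x: "f \<in> log_smooth \<Longrightarrow> (\<lambda>x. f x / x) \<in> log_smooth"
| diff: "f \<in> log_smooth \<Longrightarrow> g \<in> log_smooth \<Longrightarrow> (\<lambda>x. f x - g x) \<in> log_smooth"

lemma log_smooth_derivative:
  "f \<in> log_smooth \<Longrightarrow> \<exists>f'\<in>log_smooth. \<forall>x>0. (f has_real_derivative f' x) (at x)"
proof (induction rule: log_smooth.induct)
  case (comp_ln g)
  then obtain A where A: "completely_monotone A" "\<And>s. (g has_real_derivative - A s) (at s)"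
    using completely_monotone_derivative by blast
  show ?case
  proof (intro bexI allI impI)
    show "(\<lambda>x. A (- ln x) / x) \<in> log_smooth"
      by (intro log_smooth.intros A)
    fix x :: real assume "x > 0"
    have "((\<lambda>x. g (- ln x)) has_real_derivative - A (- ln x) * (- (1 / x))) (at x)"
      using \<open>x > 0\<close> by (intro DERIV_chain2[OF A(2)]) (auto intro!: derivative_eq_intros)
    then show "((\<lambda>x. g (- ln x)) has_real_derivative A (- ln x) / x) (at x)" by simp
  qed
next
  case (over_x f)
  then obtain f' where f': "f' \<in> log_smooth" "\<And>x. x > 0 \<Longrightarrow> (f has_real_derivative f' x) (at x)"
    by blast
  show ?case
  proof (intro bexI allI impI)
    show "(\<lambda>x. f' x / x - f x / x / x) \<in> log_smooth"
      by (intro log_smooth.intros f' over_x)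
    fix x :: real assume "x > 0"
    then show "((\<lambda>x. f x / x) has_real_derivative f' x / x - f x / x / x) (at x)"
      by (auto intro!: derivative_eq_intros f'(2) simp: field_simps)
  qed
next
  case (diff f g)
  then obtain f' g' where
    "f' \<in> log_smooth" "\<And>x. x > 0 \<Longrightarrow> (f has_real_derivative f' x) (at x)"
    "g' \<in> log_smooth" "\<And>x. x > 0 \<Longrightarrow> (g has_real_derivative g' x) (at x)"
    by blast
  then show ?case
    by (intro bexI[of _ "\<lambda>x. f' x - g' x"]) (auto intro!: log_smooth.intros derivative_intros)
qed

text \<open>On \<open>(0, \<infinity>)\<close> the function \<open>F\<close> is the composition of \<open>s \<mapsto> F(e\<^sup>-\<^sup>s)\<close> with \<open>x \<mapsto> - ln x\<close>, so it
agrees there with a member of \<open>log_smooth\<close>, which can be differentiated again and again.\<close>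

lemma smooth_if_completely_monotone_exp:
  assumes "completely_monotone (\<lambda>s. F (exp (- s)))"
  shows "\<exists>D. (\<forall>x>0. D 0 x = F x) \<and> (\<forall>n. \<forall>x>0. (D n has_real_derivative D (Suc n) x) (at x))"
proof -
  define F0 where "F0 = (\<lambda>x. F (exp (- (- ln x))))"
  have "F0 \<in> log_smooth" unfolding F0_def by (rule log_smooth.comp_ln) (rule assms)
  have "\<exists>D. \<forall>n. (D n \<in> log_smooth \<and> (n = 0 \<longrightarrow> D n = F0)) \<and>
      (\<forall>x>0. (D n has_real_derivative D (Suc n) x) (at x))"
    by (rule dependent_nat_choice) (use \<open>F0 \<in> log_smooth\<close> log_smooth_derivative in blast)+
  then obtain D where "D 0 = F0" "\<forall>n. \<forall>x>0. (D n has_real_derivative D (Suc n) x) (at x)"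
    by blast
  then show ?thesis by (intro exI[of _ D]) (auto simp: F0_def)
qed


section \<open>Non-negativity of the derivatives\<close>

lemma taylor_remainder_bound:
  fixes D :: "nat \<Rightarrow> real \<Rightarrow> real"
  assumes D: "\<And>n x. x > 0 \<Longrightarrow> (D n has_real_derivative D (Suc n) x) (at x)" and "a > 0"
  obtains M where "\<And>h. 0 \<le> h \<Longrightarrow> h \<le> 1 \<Longrightarrow>
    \<bar>D 0 (a + h) - (\<Sum>j<n. D j a / fact j * h ^ j)\<bar> \<le> M * h ^ n"
proof (cases n)
  case 0
  have "continuous_on {a..a + 1} (D 0)"
    using \<open>a > 0\<close> by (intro continuous_at_imp_continuous_on ballI DERIV_isCont[OF D]) auto
  then have "bounded (D 0 ` {a..a + 1})"
    by (intro compact_imp_bounded compact_continuous_image) auto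
  then obtain M where M: "\<And>x. x \<in> {a..a + 1} \<Longrightarrow> \<bar>D 0 x\<bar> \<le> M"
    unfolding bounded_iff by (metis imageI real_norm_def)
  then show ?thesis using 0 by (intro that[of M]) auto
next
  case (Suc n')
  have "continuous_on {a..a + 1} (D n)"
    using \<open>a > 0\<close> by (intro continuous_at_imp_continuous_on ballI DERIV_isCont[OF D]) auto
  then have "bounded (D n ` {a..a + 1})"
    by (intro compact_imp_bounded compact_continuous_image) auto
  then obtain M where M: "\<And>x. x \<in> {a..a + 1} \<Longrightarrow> \<bar>D n x\<bar> \<le> M"
    unfolding bounded_iff by (metis imageI real_norm_def)
  show ?thesis
  proof (rule that)
    fix h :: real assume h: "0 \<le> h" "h \<le> 1"
    show "\<bar>D 0 (a + h) - (\<Sum>j<n. D j a / fact j * h ^ j)\<bar> \<le> M / fact n * h ^ n"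
    proof (cases "h = 0")
      case True
      then show ?thesis using Suc by (simp add: power_0_left sum.lessThan_Suc_shift del: sum.lessThan_Suc)
    next
      case False
      then have "\<exists>t. a < t \<and> t < a + h \<and>
          D 0 (a + h) = (\<Sum>m<n. D m a / fact m * (a + h - a) ^ m) + D n t / fact n * (a + h - a) ^ n"
        using h Suc D \<open>a > 0\<close> by (intro Taylor_up[where a = a]) auto
      then obtain t where t: "a < t" "t < a + h"
        "D 0 (a + h) - (\<Sum>j<n. D j a / fact j * h ^ j) = D n t / fact n * h ^ n"
        by auto
      have "\<bar>D n t\<bar> / fact n * h ^ n \<le> M / fact n * h ^ n"
        using t h by (intro mult_right_mono divide_right_mono M) auto
      then show ?thesis using h unfolding t(3) by (simp add: abs_mult)
    qed
  qed
qed

text \<open>The square makes \<open>p = \<Prod>\<^sub>j\<^sub><\<^sub>n (x - 2\<^sup>-\<^sup>j)\<^sup>2\<close> non-negative, and the functional of \<open>k \<mapsto> (2\<^sup>-\<^sup>k)\<^sup>j\<close> at \<open>p\<close> is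
\<open>p(2\<^sup>-\<^sup>j)\<close>, which vanishes for \<open>j < n\<close> and is positive for \<open>j = n\<close>. Applied to the Taylor expansion
of \<open>D 0\<close> at \<open>a\<close>, the functional leaves \<open>b\<^sup>n (D n a / n! p(2\<^sup>-\<^sup>n) + O(b))\<close>; let \<open>b\<close> tend to 0.\<close>

lemma derivative_nonneg_if_geometric_moments:
  fixes D :: "nat \<Rightarrow> real \<Rightarrow> real"
  assumes D: "\<And>n x. x > 0 \<Longrightarrow> (D n has_real_derivative D (Suc n) x) (at x)" and "a > 0"
    and pos: "\<And>p b. nonneg_on_unit p \<Longrightarrow> b > 0 \<Longrightarrow>
      0 \<le> moment_functional p (\<lambda>k. D 0 (a + b * (1 / 2) ^ k))"
  shows "0 \<le> D n a"
proof -
  define p :: "real poly" where "p = (\<Prod>j<n. [:- ((1 / 2) ^ j), 1:] ^ 2)"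
  have p_eval: "poly p x = (\<Prod>j<n. (x - (1 / 2) ^ j) ^ 2)" for x
    by (simp add: p_def poly_prod algebra_simps)
  have "nonneg_on_unit p" by (simp add: nonneg_on_unit_def p_eval prod_nonneg)
  have p_zero: "poly p ((1 / 2) ^ j) = 0" if "j < n" for j
    using that by (auto simp: p_eval)
  have "((1 / 2) ^ n :: real) \<noteq> (1 / 2) ^ j" if "j < n" for j
    by (intro less_imp_neq power_strict_decreasing) (use that in auto)
  then have p_pos: "poly p ((1 / 2) ^ n) > 0"
    unfolding p_eval by (intro prod_pos) auto
  obtain M where M: "\<And>h. 0 \<le> h \<Longrightarrow> h \<le> 1 \<Longrightarrow>
      \<bar>D 0 (a + h) - (\<Sum>j<Suc n. D j a / fact j * h ^ j)\<bar> \<le> M * h ^ Suc n"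
    using taylor_remainder_bound[of D a "Suc n"] D \<open>a > 0\<close> by metis
  define C where "C = (\<Sum>k\<le>degree p. \<bar>coeff p k\<bar> * M)"
  have "M \<ge> 0" using M[of 1] by auto
  have bound: "0 \<le> D n a / fact n * poly p ((1 / 2) ^ n) + b * C" if b: "0 < b" "b \<le> 1" for b
  proof -
    define h where "h k = b * (1 / 2) ^ k" for k
    have h: "0 \<le> h k" "h k \<le> b" for k
      using b by (auto simp: h_def power_le_one mult_left_le)
    define R where "R k = D 0 (a + h k) - (\<Sum>j<Suc n. D j a / fact j * h k ^ j)" for k
    have R: "\<bar>R k\<bar> \<le> b ^ Suc n * M" for k
    proof -
      have "\<bar>R k\<bar> \<le> M * h k ^ Suc n" unfolding R_def using h[of k] b by (intro M) auto
      also have "\<dots> \<le> M * b ^ Suc n" using h \<open>M \<ge> 0\<close> by (intro mult_left_mono power_mono)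
      finally show ?thesis by (simp add: mult.commute)
    qed
    have poly_part: "moment_functional p (\<lambda>k. \<Sum>j<Suc n. D j a / fact j * h k ^ j)
        = D n a / fact n * b ^ n * poly p ((1 / 2) ^ n)"
    proof -
      have "moment_functional p (\<lambda>k. \<Sum>j<Suc n. D j a / fact j * h k ^ j)
          = (\<Sum>j<Suc n. D j a / fact j * b ^ j * (\<Sum>k\<le>degree p. coeff p k * ((1 / 2) ^ j) ^ k))"
        unfolding moment_functional_def sum_distrib_left
        by (subst sum.swap) (simp add: h_def power_mult_distrib mult_ac flip: power_mult)
      also have "\<dots> = (\<Sum>j<Suc n. D j a / fact j * b ^ j * poly p ((1 / 2) ^ j))"
        by (simp only: poly_altdef)
      also have "\<dots> = D n a / fact n * b ^ n * poly p ((1 / 2) ^ n)"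
        by (simp add: p_zero)
      finally show ?thesis .
    qed
    have "0 \<le> moment_functional p (\<lambda>k. D 0 (a + h k))"
      unfolding h_def using \<open>nonneg_on_unit p\<close> b(1) by (rule pos)
    also have "\<dots> = moment_functional p (\<lambda>k. 1 * (\<Sum>j<Suc n. D j a / fact j * h k ^ j) + 1 * R k)"
      by (simp add: R_def)
    also have "\<dots> = D n a / fact n * b ^ n * poly p ((1 / 2) ^ n) + moment_functional p R"
      unfolding moment_functional_linear poly_part by simp
    also have "moment_functional p R \<le> (\<Sum>k\<le>degree p. \<bar>coeff p k\<bar> * (b ^ Suc n * M))"
      unfolding moment_functional_def
    proof (rule sum_mono)
      fix k
      have "coeff p k * R k \<le> \<bar>coeff p k\<bar> * \<bar>R k\<bar>" by (metis abs_ge_self abs_mult)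
      also have "\<dots> \<le> \<bar>coeff p k\<bar> * (b ^ Suc n * M)" by (intro mult_left_mono R) auto
      finally show "coeff p k * R k \<le> \<bar>coeff p k\<bar> * (b ^ Suc n * M)" .
    qed
    also have "\<dots> = b ^ n * (b * C)" by (simp add: C_def sum_distrib_left mult_ac)
    finally have "0 \<le> b ^ n * (D n a / fact n * poly p ((1 / 2) ^ n) + b * C)"
      by (simp add: algebra_simps)
    then show ?thesis using zero_less_power[OF b(1), of n] by (simp only: zero_le_mult_iff) auto
  qed
  have "0 \<le> D n a / fact n * poly p ((1 / 2) ^ n)"
  proof (rule tendsto_lowerbound)
    show "((\<lambda>b. D n a / fact n * poly p ((1 / 2) ^ n) + b * C)
        \<longlongrightarrow> D n a / fact n * poly p ((1 / 2) ^ n)) (at_right 0)"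
      by (auto intro!: tendsto_eq_intros)
    show "\<forall>\<^sub>F b in at_right 0. 0 \<le> D n a / fact n * poly p ((1 / 2) ^ n) + b * C"
      unfolding eventually_at_right_field by (intro exI[of _ 1]) (use bound in auto)
  qed auto
  then have "0 \<le> D n a / fact n" using p_pos by (simp only: zero_le_mult_iff) auto
  then show ?thesis by (simp add: pos_le_divide_eq)
qed

section \<open>Bernstein's theorem on a half-line\<close>

text \<open>All terms and the Lagrange remainder are non-negative, so the partial sums stay below the value of
the function. Applied at \<open>x\<close> and evaluated at the point \<open>y\<close> twice as far from \<open>x\<close> as \<open>a\<close> is, this
bounds \<open>D n x / n! (y - x)\<^sup>n\<close> by \<open>D 0 y\<close>; as \<open>D n\<close> increases, the remainder at \<open>x\<close> is at most
\<open>2\<^sup>-\<^sup>n D 0 y\<close>.\<close>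

lemma taylor_sums_if_derivatives_nonneg:
  fixes D :: "nat \<Rightarrow> real \<Rightarrow> real"
  assumes D: "\<And>n x. x > 0 \<Longrightarrow> (D n has_real_derivative D (Suc n) x) (at x)"
    and nonneg: "\<And>n x. x > 0 \<Longrightarrow> 0 \<le> D n x" and "0 < a" "a < x"
  shows "(\<lambda>m. D m a / fact m * (x - a) ^ m) sums D 0 x"
proof -
  have taylor: "\<exists>t. a < t \<and> t < x \<and>
      D 0 x = (\<Sum>m<n. D m a / fact m * (x - a) ^ m) + D n t / fact n * (x - a) ^ n"
    if "n > 0" "0 < a" "a < x" for n a x
    using that D by (intro Taylor_up[where a = a]) auto
  have partial_le: "(\<Sum>m<n. D m a / fact m * (x - a) ^ m) \<le> D 0 x"
    if "n > 0" "0 < a" "a < x" for n a x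
  proof -
    obtain t where "a < t" "t < x"
      "D 0 x = (\<Sum>m<n. D m a / fact m * (x - a) ^ m) + D n t / fact n * (x - a) ^ n"
      using taylor[OF \<open>n > 0\<close> \<open>0 < a\<close> \<open>a < x\<close>] by blast
    moreover have "0 \<le> D n t / fact n * (x - a) ^ n"
      using \<open>0 < a\<close> \<open>a < x\<close> \<open>a < t\<close> nonneg by simp
    ultimately show ?thesis by linarith
  qed
  have mono: "D n t \<le> D n x" if "0 < t" "t \<le> x" for n t x
    by (rule DERIV_nonneg_imp_nondecreasing[OF \<open>t \<le> x\<close>]) (meson D nonneg less_le_trans \<open>0 < t\<close>)
  define y where "y = x + 2 * (x - a)"
  have "0 < x" "x < y" using assms(3,4) by (auto simp: y_def)
  have lower: "D 0 x - (1 / 2) ^ n * D 0 y \<le> (\<Sum>m<n. D m a / fact m * (x - a) ^ m)" if "n > 0" for n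
  proof -
    obtain t where t: "a < t" "t < x"
      "D 0 x = (\<Sum>m<n. D m a / fact m * (x - a) ^ m) + D n t / fact n * (x - a) ^ n"
      using taylor[OF \<open>n > 0\<close> \<open>0 < a\<close> \<open>a < x\<close>] by blast
    have "D n t / fact n * (x - a) ^ n \<le> D n x / fact n * (x - a) ^ n"
      using t assms(3,4) by (intro mult_right_mono divide_right_mono mono) auto
    also have "\<dots> = (1 / 2) ^ n * (D n x / fact n * (y - x) ^ n)"
    proof -
      have "(x - a) ^ n = (1 / 2) ^ n * (y - x) ^ n"
        unfolding power_mult_distrib[symmetric] by (rule arg_cong[of _ _ "\<lambda>x. x ^ n"]) (simp add: y_def)
      then show ?thesis by simp
    qed
    also have "D n x / fact n * (y - x) ^ n \<le> (\<Sum>m<Suc n. D m x / fact m * (y - x) ^ m)"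
      using \<open>0 < x\<close> \<open>x < y\<close> nonneg by (intro member_le_sum[of n]) auto
    also have "\<dots> \<le> D 0 y"
      using \<open>0 < x\<close> \<open>x < y\<close> by (intro partial_le) auto
    finally show ?thesis using t(3) by simp
  qed
  show ?thesis
    unfolding sums_def
  proof (rule tendsto_sandwich)
    have "(\<lambda>n. (1 / 2) ^ n * D 0 y) \<longlonglongrightarrow> 0 * D 0 y"
      by (intro tendsto_mult tendsto_const LIMSEQ_power_zero) simp
    from tendsto_diff[OF tendsto_const this, of "D 0 x"]
    show "(\<lambda>n. D 0 x - (1 / 2) ^ n * D 0 y) \<longlonglongrightarrow> D 0 x" by simp
    show "\<forall>\<^sub>F n in sequentially. D 0 x - (1 / 2) ^ n * D 0 y \<le> (\<Sum>m<n. D m a / fact m * (x - a) ^ m)"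
      by (rule eventually_mono[OF eventually_gt_at_top[of 0]]) (rule lower)
    show "\<forall>\<^sub>F n in sequentially. (\<Sum>m<n. D m a / fact m * (x - a) ^ m) \<le> D 0 x"
      by (rule eventually_mono[OF eventually_gt_at_top[of 0]]) (rule partial_le[OF _ assms(3,4)])
  qed auto
qed

lemma entire_if_derivatives_nonneg:
  fixes D :: "nat \<Rightarrow> real \<Rightarrow> real"
  assumes D: "\<And>n x. x > 0 \<Longrightarrow> (D n has_real_derivative D (Suc n) x) (at x)"
    and nonneg: "\<And>n x. x > 0 \<Longrightarrow> 0 \<le> D n x" and "a > 0"
  obtains G where "G holomorphic_on UNIV" "\<And>x. x > a \<Longrightarrow> G (complex_of_real x) = complex_of_real (D 0 x)"
proof -
  define c where "c m = complex_of_real (D m a / fact m)" for m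
  define G where "G z = (\<Sum>m. c m * (z - of_real a) ^ m)" for z
  have sums_D: "(\<lambda>m. D m a / fact m * (x - a) ^ m) sums D 0 x" if "x > a" for x
    using D nonneg \<open>a > 0\<close> that by (rule taylor_sums_if_derivatives_nonneg)
  have G: "(\<lambda>m. c m * (z - of_real a) ^ m) sums G z" for z
  proof -
    have "summable (\<lambda>m. c m * (z - of_real a) ^ m)"
    proof (rule summable_comparison_test)
      define r where "r = norm (z - of_real a)"
      show "summable (\<lambda>m. D m a / fact m * (a + (r + 1) - a) ^ m)"
        by (rule sums_summable[OF sums_D]) (simp add: r_def add_nonneg_pos)
      have "norm (c m * (z - of_real a) ^ m) \<le> D m a / fact m * (r + 1) ^ m" for m
        using nonneg[OF \<open>a > 0\<close>, of m]
        by (auto simp: c_def norm_mult norm_power norm_divide r_def intro!: mult_left_mono divide_right_mono power_mono)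
      then show "\<exists>N. \<forall>m\<ge>N. norm (c m * (z - of_real a) ^ m) \<le> D m a / fact m * (a + (r + 1) - a) ^ m"
        by simp
    qed
    then show ?thesis unfolding G_def by (rule summable_sums)
  qed
  show thesis
  proof (rule that)
    have "G holomorphic_on (\<Union>r\<in>UNIV. ball (of_real a) r)"
      by (intro holomorphic_on_UN_open power_series_holomorphic[of _ _ c] G) auto
    also have "(\<Union>r\<in>UNIV. ball (complex_of_real a) r) = UNIV"
      using gt_ex by (auto simp: mem_ball)
    finally show "G holomorphic_on UNIV" .
    fix x assume "x > a"
    from sums_D[OF this]
    have "(\<lambda>m. complex_of_real (D m a / fact m * (x - a) ^ m)) sums complex_of_real (D 0 x)"
      by (rule sums_of_real)
    then have "(\<lambda>m. c m * (of_real x - of_real a) ^ m) sums complex_of_real (D 0 x)"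
      by (simp add: c_def)
    then show "G (of_real x) = of_real (D 0 x)"
      by (rule sums_unique2[OF G])
  qed
qed

lemma entire_eq_if_eq_on_ray:
  assumes "f holomorphic_on UNIV" "g holomorphic_on UNIV"
    and eq: "\<And>x. x > a \<Longrightarrow> f (complex_of_real x) = g (complex_of_real x)"
  shows "f z = g z"
proof -
  have "f z - g z = 0"
  proof (rule analytic_continuation[where f = "\<lambda>z. f z - g z" and S = UNIV
        and U = "complex_of_real ` {a<..}" and \<xi> = "complex_of_real (a + 1)"])
    show "(\<lambda>z. f z - g z) holomorphic_on UNIV" using assms by (intro holomorphic_intros)
    have "(a + 1) islimpt {a<..}"
      by (rule interior_limit_point) (simp add: interior_open)
    then show "complex_of_real (a + 1) islimpt complex_of_real ` {a<..}"
    proof (rule islimpt_isCont_image)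
      show "\<forall>\<^sub>F x in at (a + 1). complex_of_real x \<noteq> complex_of_real (a + 1)"
        unfolding of_real_eq_iff by (simp add: eventually_at_filter)
    qed simp
  qed (use eq in auto)
  then show ?thesis by simp
qed

text \<open>The Taylor series at different base points \<open>a\<close> define the same entire function \<open>G\<close> by the identity
theorem, since all of them agree with \<open>D 0\<close> far to the right. So \<open>G\<close> extends \<open>D 0\<close> on all of \<open>(0, \<infinity>)\<close>,
its derivatives there are the values \<open>D n x \<ge> 0\<close>, and the sign passes to the limit \<open>x = 0\<close>.\<close>

lemma absolutely_monotonic_entire_if_derivatives_nonneg:
  fixes D :: "nat \<Rightarrow> real \<Rightarrow> real"
  assumes D: "\<And>n x. x > 0 \<Longrightarrow> (D n has_real_derivative D (Suc n) x) (at x)"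
    and nonneg: "\<And>n x. x > 0 \<Longrightarrow> 0 \<le> D n x"
  obtains G where "absolutely_monotonic_entire G" "\<And>x. x > 0 \<Longrightarrow> G (complex_of_real x) = complex_of_real (D 0 x)"
proof -
  obtain G where G: "G holomorphic_on UNIV"
    "\<And>x. x > 1 \<Longrightarrow> G (complex_of_real x) = complex_of_real (D 0 x)"
    using entire_if_derivatives_nonneg[of D 1, OF D nonneg] by auto
  have G_eq: "G (of_real x) = of_real (D 0 x)" if "x > 0" for x
  proof -
    define a where "a = x / 2"
    have "0 < a" "a < x" using that by (simp_all add: a_def)
    obtain G' where G': "G' holomorphic_on UNIV"
      "\<And>y. y > a \<Longrightarrow> G' (complex_of_real y) = complex_of_real (D 0 y)"
      using entire_if_derivatives_nonneg[of D a, OF D nonneg \<open>0 < a\<close>] by blast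
    have "G (of_real x) = G' (of_real x)"
      by (rule entire_eq_if_eq_on_ray[OF G(1) G'(1), of "max 1 a"]) (auto simp: G(2) G'(2))
    then show ?thesis using \<open>a < x\<close> G'(2) by simp
  qed
  have deriv_hol: "(deriv ^^ n) G holomorphic_on UNIV" for n
    using G(1) by (intro holomorphic_higher_deriv) auto
  have deriv_eq: "(deriv ^^ n) G (of_real x) = of_real (D n x)" if "x > 0" for n x
    using that
  proof (induction n arbitrary: x)
    case 0
    then show ?case by (simp add: G_eq)
  next
    case (Suc n)
    have "((deriv ^^ n) G has_field_derivative (deriv ^^ Suc n) G (of_real x)) (at (of_real x))"
      using holomorphic_derivI[OF deriv_hol open_UNIV UNIV_I] by simp
    then have 1: "((\<lambda>x. (deriv ^^ n) G (of_real x)) has_vector_derivative (deriv ^^ Suc n) G (of_real x)) (at x)"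
      by (rule has_vector_derivative_real_field)
    have "((\<lambda>x. complex_of_real (D n x)) has_vector_derivative of_real (D (Suc n) x)) (at x)"
      using D[OF Suc.prems] by (rule has_vector_derivative_of_real)
    then have 2: "((\<lambda>x. (deriv ^^ n) G (of_real x)) has_vector_derivative of_real (D (Suc n) x)) (at x)"
      by (rule has_vector_derivative_transform_within_open[of _ _ _ "{0<..}"])
         (use Suc in auto)
    show ?case using vector_derivative_unique_at[OF 1 2] .
  qed
  have "(deriv ^^ n) G 0 \<in> \<real>\<^sub>\<ge>\<^sub>0" for n
  proof (rule Lim_in_closed_set)
    have "isCont ((deriv ^^ n) G) (of_real 0)"
      using deriv_hol[of n] holomorphic_on_imp_continuous_on continuous_on_eq_continuous_at open_UNIV by blast
    then have "isCont (\<lambda>x. (deriv ^^ n) G (of_real x)) (0 :: real)"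
      by (rule isCont_o2[rotated]) simp
    then have "((\<lambda>x. (deriv ^^ n) G (of_real x)) \<longlongrightarrow> (deriv ^^ n) G (of_real 0)) (at (0 :: real))"
      by (simp only: isCont_def)
    then show "((\<lambda>x. (deriv ^^ n) G (of_real x)) \<longlongrightarrow> (deriv ^^ n) G 0) (at_right (0 :: real))"
      by (simp only: of_real_0) (erule tendsto_mono[rotated], rule at_le, simp)
    show "\<forall>\<^sub>F x in at_right 0. (deriv ^^ n) G (complex_of_real x) \<in> \<real>\<^sub>\<ge>\<^sub>0"
      unfolding eventually_at_right_field
      by (intro exI[of _ 1] conjI allI impI zero_less_one) (simp only: deriv_eq nonneg_Reals_of_real_iff nonneg)
  qed simp_all
  then have "(deriv ^^ n) G 0 / of_real (fact n) \<in> \<real>\<^sub>\<ge>\<^sub>0" for n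
    by (intro nonneg_Reals_divide_I) (simp_all only: nonneg_Reals_of_real_iff fact_ge_zero)
  then have "(deriv ^^ n) G 0 / fact n \<in> \<real>\<^sub>\<ge>\<^sub>0" for n
    by (simp only: of_real_fact)
  then show thesis
    using that[of G] G(1) G_eq by (simp add: absolutely_monotonic_entire_def)
qed

section \<open>Moments and test polynomials\<close>

lemma two_point_moments:
  assumes "0 \<le> a" "0 \<le> b" "0 \<le> u" "u \<le> 1"
  shows "(\<lambda>k. (- 1) ^ k * (a + b * u ^ k)) \<in> moment_sequences {-1..0}"
proof -
  define P where "P = point_measure {True, False} (\<lambda>i. ennreal (if i then a else b))"
  define X where "X i = (if i then -1 else - u)" for i
  define \<mu> where "\<mu> = distr P borel X"
  have [measurable]: "X \<in> P \<rightarrow>\<^sub>M borel" by (simp add: P_def point_measure_def)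
  have int: "integrable P f" for f :: "bool \<Rightarrow> real"
    unfolding P_def by (rule integrable_point_measure_finite) simp
  have "integral\<^sup>L P f = a * f True + b * f False" for f :: "bool \<Rightarrow> real"
    unfolding P_def using assms by (subst lebesgue_integral_point_measure_finite) auto
  then have "moment \<mu> = (\<lambda>k. (- 1) ^ k * (a + b * u ^ k))"
    by (auto simp: moment_def \<mu>_def integral_distr X_def power_minus[of u] algebra_simps)
  moreover have "admissible_measure \<mu>"
    by (simp add: admissible_measure_def \<mu>_def integrable_distr_eq int)
  moreover have "AE x in \<mu>. x \<in> {-1..0}"
    unfolding \<mu>_def by (subst AE_distr_iff) (use assms in \<open>auto simp: X_def\<close>)
  ultimately show ?thesis
    unfolding moment_sequences_def mem_Collect_eq by (intro exI[of _ \<mu>] conjI) simp_all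
qed

lemma moment_functional_eq_integral:
  assumes "admissible_measure \<sigma>"
  shows "integrable \<sigma> (\<lambda>x. poly p (- x))"
    and "moment_functional p (\<lambda>k. (- 1) ^ k * moment \<sigma> k) = (\<integral>x. poly p (- x) \<partial>\<sigma>)"
proof -
  have int: "integrable \<sigma> (\<lambda>x. x ^ k)" for k
    using assms by (simp add: admissible_measure_def)
  have eq: "poly p (- x) = (\<Sum>k\<le>degree p. coeff p k * (- 1) ^ k * x ^ k)" for x :: real
    by (simp add: poly_altdef power_minus[of x] mult_ac)
  show "integrable \<sigma> (\<lambda>x. poly p (- x))"
    unfolding eq by (intro Bochner_Integration.integrable_sum integrable_mult_right int)
  show "moment_functional p (\<lambda>k. (- 1) ^ k * moment \<sigma> k) = (\<integral>x. poly p (- x) \<partial>\<sigma>)"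
    unfolding eq moment_functional_def moment_def
    by (subst Bochner_Integration.integral_sum) (auto intro!: integrable_mult_right int sum.cong simp: mult_ac)
qed

text \<open>Integrate \<open>p(-x) \<ge> 0\<close>: the factors \<open>(-1)\<^sup>k\<close> move the measure to \<open>[0, \<infinity>)\<close>.\<close>

lemma half_line_moment_functional_nonneg:
  assumes "m \<in> moment_sequences {..0}" and "\<And>x. x \<ge> 0 \<Longrightarrow> 0 \<le> poly p x"
  shows "0 \<le> moment_functional p (\<lambda>k. (- 1) ^ k * m k)"
proof -
  obtain \<sigma> where \<sigma>: "admissible_measure \<sigma>" "AE x in \<sigma>. x \<in> {..0}" "m = moment \<sigma>"
    using assms(1) by (auto simp: moment_sequences_def)
  have "AE x in \<sigma>. 0 \<le> poly p (- x)"
    using \<sigma>(2) by eventually_elim (simp add: assms(2))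
  then show ?thesis
    unfolding \<sigma>(3) moment_functional_eq_integral(2)[OF \<sigma>(1)] by (rule integral_nonneg_AE)
qed

text \<open>Bounded moments confine the measure to \<open>[-1, 0]\<close>, so that non-negativity of \<open>p\<close> on \<open>[0, 1]\<close> is
enough: by Bernoulli's inequality \<open>k (y - 1) \<le> y\<^sup>k\<close> for \<open>y = -x \<ge> 1\<close>, so \<open>k\<close> times the integral of
the excess \<open>h\<close> of \<open>y\<close> over 1 is at most \<open>C\<close> for every \<open>k\<close>.\<close>

lemma bounded_moment_functional_nonneg:
  assumes "m \<in> moment_sequences {..0}" and bound: "\<And>k. (- 1) ^ k * m k \<le> C"
    and "nonneg_on_unit p"
  shows "0 \<le> moment_functional p (\<lambda>k. (- 1) ^ k * m k)"
proof -
  obtain \<sigma> where \<sigma>: "admissible_measure \<sigma>" "AE x in \<sigma>. x \<in> {..0}" "m = moment \<sigma>"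
    using assms(1) by (auto simp: moment_sequences_def)
  have sets [measurable_cong]: "sets \<sigma> = sets borel"
    using \<sigma>(1) by (simp add: admissible_measure_def)
  define h where "h x = max (- x - 1) 0" for x :: real
  have int_x: "integrable \<sigma> (\<lambda>x. x)"
    using \<sigma>(1) spec[of "\<lambda>k. integrable \<sigma> (\<lambda>x. x ^ k)" 1]
    by (simp add: admissible_measure_def)
  have int_h: "integrable \<sigma> h"
  proof (rule Bochner_Integration.integrable_bound[OF int_x])
    show "h \<in> borel_measurable \<sigma>" unfolding h_def by measurable
  qed (auto simp: h_def)
  have "real k * integral\<^sup>L \<sigma> h \<le> C" for k
  proof -
    have "real k * integral\<^sup>L \<sigma> h = (\<integral>x. real k * h x \<partial>\<sigma>)" by simp
    also have "\<dots> \<le> (\<integral>x. poly (monom 1 k) (- x) \<partial>\<sigma>)"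
    proof (rule integral_mono_AE)
      show "integrable \<sigma> (\<lambda>x. real k * h x)" using int_h by simp
      show "integrable \<sigma> (\<lambda>x. poly (monom 1 k) (- x))"
        by (rule moment_functional_eq_integral(1)[OF \<sigma>(1)])
      show "AE x in \<sigma>. real k * h x \<le> poly (monom 1 k) (- x)"
        using \<sigma>(2)
      proof eventually_elim
        case (elim x)
        have "1 + real k * (- x - 1) \<le> (- x) ^ k" if "- x - 1 \<ge> 0"
          using Bernoulli_inequality[of "- x - 1" k] that by simp
        then show ?case using elim by (auto simp: h_def max_def poly_monom)
      qed
    qed
    also have "\<dots> = (- 1) ^ k * m k"
      unfolding moment_functional_eq_integral(2)[OF \<sigma>(1), symmetric] \<sigma>(3)
      by (rule moment_functional_monom)
    also have "\<dots> \<le> C" by (rule bound)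
    finally show ?thesis .
  qed
  then have "integral\<^sup>L \<sigma> h \<le> 0"
    by (metis linorder_not_le mult.commute reals_Archimedean3)
  moreover have "0 \<le> integral\<^sup>L \<sigma> h" by (intro integral_nonneg_AE) (simp add: h_def)
  ultimately have "integral\<^sup>L \<sigma> h = 0" by simp
  then have "AE x in \<sigma>. h x = 0"
    by (subst (asm) integral_nonneg_eq_0_iff_AE[OF int_h]) (auto simp: h_def)
  with \<sigma>(2) have "AE x in \<sigma>. 0 \<le> poly p (- x)"
  proof eventually_elim
    case (elim x)
    then have "- x \<in> {0..1}" by (auto simp: h_def max_def split: if_splits)
    then show ?case using assms(3) by (simp add: nonneg_on_unit_def)
  qed
  then show ?thesis
    unfolding \<sigma>(3) moment_functional_eq_integral(2)[OF \<sigma>(1)] by (rule integral_nonneg_AE)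
qed

section \<open>Transforms that preserve moment sequences\<close>

text \<open>The measure with mass \<open>a\<close> at \<open>-1\<close> and \<open>b\<close> at \<open>-u\<close> has moments \<open>(-1)\<^sup>k (a + b u\<^sup>k)\<close>; the sequence \<open>T\<close>
below holds the moments of the transformed measure, reflected to \<open>[0, \<infinity>)\<close>. For \<open>b = 0\<close> it is
\<open>F a, - F (- a), F a, - F (- a)\<close> and so on, and the polynomials \<open>(1 - x)\<^sup>2\<close> and \<open>x (1 - x)\<^sup>2\<close> compare its
two values in both directions. For \<open>u = 0\<close> it is \<open>F (a + b), F a, F a\<close> and so on, and \<open>(1 - x)\<^sup>2\<close>
yields \<open>F a \<le> F (a + b)\<close>. Monotonicity bounds the moments by \<open>F (a + b)\<close>.\<close>

lemma preserver_geometric_moments: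
  fixes F :: "real \<Rightarrow> real"
  assumes preserves: "\<forall>s\<in>moment_sequences {-1..0}. entrywise F s \<in> moment_sequences {..0}"
  shows "F 0 = 0" and "a \<ge> 0 \<Longrightarrow> F (- a) = - F a"
    and "0 \<le> a \<Longrightarrow> 0 \<le> b \<Longrightarrow> 0 \<le> u \<Longrightarrow> u \<le> 1 \<Longrightarrow> nonneg_on_unit p \<Longrightarrow>
      0 \<le> moment_functional p (\<lambda>k. F (a + b * u ^ k))"
proof -
  define T where "T a b u k = (- 1) ^ k * F ((- 1) ^ k * (a + b * u ^ k))" for a b u :: real and k
  have T_moments: "(\<lambda>k. F ((- 1) ^ k * (a + b * u ^ k))) \<in> moment_sequences {..0}"
    if "0 \<le> a" "0 \<le> b" "0 \<le> u" "u \<le> 1" for a b u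
    using bspec[OF preserves two_point_moments[OF that]] by (simp add: entrywise_def)
  have half: "0 \<le> moment_functional p (T a b u)"
    if "0 \<le> a" "0 \<le> b" "0 \<le> u" "u \<le> 1" "\<And>x. x \<ge> 0 \<Longrightarrow> 0 \<le> poly p x" for a b u p
    unfolding T_def using half_line_moment_functional_nonneg[OF T_moments] that by blast
  \<comment> \<open>The zero measure is sent to a measure on \<open>(-\<infinity>, 0]\<close> all of whose moments are \<open>F 0\<close>; the odd ones cannot be positive.\<close>
  show F0: "F 0 = 0"
    using half[of 0 0 0 "[:1:]"] half[of 0 0 0 "[:0, 1:]"]
    by (simp add: moment_functional_pCons T_def)
  have sq: "poly [:1, -2, 1:] x = (1 - x) ^ 2" "poly [:0, 1, -2, 1:] x = x * (1 - x) ^ 2" for x :: real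
    by (simp_all add: power2_eq_square algebra_simps)
  have odd: "F (- a) = - F a" if "a \<ge> 0" for a
  proof -
    have "0 \<le> moment_functional [:1, -2, 1:] (T a 0 0)" "0 \<le> moment_functional [:0, 1, -2, 1:] (T a 0 0)"
      by (rule half; use that in \<open>simp add: sq del: poly_pCons\<close>)+
    then show ?thesis by (simp add: moment_functional_pCons T_def)
  qed
  show "F (- a) = - F a" if "a \<ge> 0" using odd that .
  have T_eq: "T a b u k = F (a + b * u ^ k)" if "0 \<le> a" "0 \<le> b" "0 \<le> u" for a b u k
    using that odd[of "a + b * u ^ k"] by (cases "even k") (simp_all add: T_def)
  have mono: "F x \<le> F y" if "0 \<le> x" "x \<le> y" for x y
  proof -
    have "0 \<le> moment_functional [:1, -2, 1:] (T x (y - x) 0)"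
      by (rule half; use that in \<open>simp add: sq del: poly_pCons\<close>)
    then show ?thesis using that by (simp add: moment_functional_pCons T_eq)
  qed
  show "0 \<le> moment_functional p (\<lambda>k. F (a + b * u ^ k))"
    if "0 \<le> a" "0 \<le> b" "0 \<le> u" "u \<le> 1" "nonneg_on_unit p"
  proof -
    have "0 \<le> moment_functional p (T a b u)"
      unfolding T_def
    proof (rule bounded_moment_functional_nonneg[OF T_moments])
      fix k
      have "F (a + b * u ^ k) \<le> F (a + b)"
        using that by (intro mono) (auto simp: mult_left_le power_le_one)
      then show "(- 1) ^ k * F ((- 1) ^ k * (a + b * u ^ k)) \<le> F (a + b)"
        using T_eq that by (simp add: T_def)
    qed (use that in auto)
    also have "T a b u = (\<lambda>k. F (a + b * u ^ k))" using T_eq that by auto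
    finally show ?thesis .
  qed
qed

lemma absolutely_monotonic_if_preserver:
  fixes F :: "real \<Rightarrow> real"
  assumes preserves: "\<forall>s\<in>moment_sequences {-1..0}. entrywise F s \<in> moment_sequences {..0}"
  obtains G where "absolutely_monotonic_entire G"
    "\<And>x. x > 0 \<Longrightarrow> G (complex_of_real x) = complex_of_real (F x)"
proof -
  note geometric = preserver_geometric_moments(3)[OF preserves]
  have "completely_monotone (\<lambda>s. F (exp (- s)))"
    unfolding completely_monotone_def
  proof (intro allI impI)
    fix p s and \<delta> :: real assume "nonneg_on_unit p" "\<delta> > 0"
    then have "0 \<le> moment_functional p (\<lambda>k. F (0 + exp (- s) * exp (- \<delta>) ^ k))"
      by (intro geometric) auto
    then show "0 \<le> moment_functional p (\<lambda>k. F (exp (- (s + real k * \<delta>))))"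
      by (simp add: algebra_simps exp_diff exp_minus divide_inverse power_inverse flip: exp_of_nat_mult)
  qed
  from smooth_if_completely_monotone_exp[OF this]
  obtain D where D: "\<And>x. x > 0 \<Longrightarrow> D 0 x = F x"
    "\<And>n x. x > 0 \<Longrightarrow> (D n has_real_derivative D (Suc n) x) (at x)"
    by blast
  have "0 \<le> D n a" if "a > 0" for n a
  proof (rule derivative_nonneg_if_geometric_moments[of D, OF D(2) \<open>a > 0\<close>])
    fix p and b :: real assume "nonneg_on_unit p" "b > 0"
    then have "0 \<le> moment_functional p (\<lambda>k. F (a + b * (1 / 2) ^ k))"
      using \<open>a > 0\<close> by (intro geometric) auto
    also have "(\<lambda>k. F (a + b * (1 / 2) ^ k)) = (\<lambda>k. D 0 (a + b * (1 / 2) ^ k))"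
      using \<open>a > 0\<close> \<open>b > 0\<close> by (intro ext D(1)[symmetric] add_pos_pos mult_pos_pos) auto
    finally show "0 \<le> moment_functional p (\<lambda>k. D 0 (a + b * (1 / 2) ^ k))" .
  qed
  then obtain G where "absolutely_monotonic_entire G"
    "\<And>x. x > 0 \<Longrightarrow> G (complex_of_real x) = complex_of_real (D 0 x)"
    using absolutely_monotonic_entire_if_derivatives_nonneg[of D, OF D(2)] by blast
  then show thesis using that D(1) by metis
qed

section \<open>Power series in moments\<close>

lemma moment_sequences_mono:
  assumes "K \<subseteq> L"
  shows "moment_sequences K \<subseteq> moment_sequences L"
proof
  fix s assume "s \<in> moment_sequences K"
  then obtain \<mu> where \<mu>: "admissible_measure \<mu>" "AE x in \<mu>. x \<in> K" "s = moment \<mu>"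
    by (auto simp: moment_sequences_def)
  have "AE x in \<mu>. x \<in> L"
    using \<mu>(2) by eventually_elim (use assms in blast)
  with \<mu> show "s \<in> moment_sequences L"
    unfolding moment_sequences_def by blast
qed

text \<open>The law of a product of \<open>n\<close> independent random variables with law \<open>N\<close>, that is, the \<open>n\<close>-fold
multiplicative convolution power of \<open>N\<close>.\<close>

primrec product_law :: "real measure \<Rightarrow> nat \<Rightarrow> real measure" where
  "product_law N 0 = return borel 1"
| "product_law N (Suc n) = distr (N \<Otimes>\<^sub>M product_law N n) borel (\<lambda>(x, y). x * y)"

lemma product_law_prob:
  assumes "prob_space N" and [measurable_cong]: "sets N = sets borel"
  shows "prob_space (product_law N n)" and "sets (product_law N n) = sets borel"
proof -
  have "prob_space (product_law N n) \<and> sets (product_law N n) = sets borel"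
  proof (induction n)
    case 0
    show ?case by (auto intro!: prob_space_return)
  next
    case (Suc n)
    then have [measurable_cong]: "sets (product_law N n) = sets borel" by simp
    interpret N: prob_space N by fact
    interpret Q: prob_space "product_law N n" using Suc by simp
    interpret pair_prob_space N "product_law N n" ..
    have "prob_space (distr (N \<Otimes>\<^sub>M product_law N n) borel (\<lambda>(x, y). x * y))"
      by (rule prob_space_distr) measurable
    then show ?case by simp
  qed
  then show "prob_space (product_law N n)" "sets (product_law N n) = sets borel" by auto
qed

lemma product_law_abs_moment:
  assumes "prob_space N" and [measurable_cong]: "sets N = sets borel"
  shows "(\<integral>\<^sup>+x. ennreal (\<bar>x\<bar> ^ k) \<partial>product_law N n) = (\<integral>\<^sup>+x. ennreal (\<bar>x\<bar> ^ k) \<partial>N) ^ n"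
proof (induction n)
  case 0
  show ?case by (simp add: nn_integral_return)
next
  case (Suc n)
  note [measurable_cong] = product_law_prob(2)[OF assms, of n]
  interpret P: prob_space "product_law N n" by (rule product_law_prob[OF assms])
  have "(\<integral>\<^sup>+x. ennreal (\<bar>x\<bar> ^ k) \<partial>product_law N (Suc n))
      = (\<integral>\<^sup>+z. ennreal (\<bar>fst z * snd z\<bar> ^ k) \<partial>(N \<Otimes>\<^sub>M product_law N n))"
    by (simp add: nn_integral_distr case_prod_unfold)
  also have "\<dots> = (\<integral>\<^sup>+x. \<integral>\<^sup>+y. ennreal (\<bar>x * y\<bar> ^ k) \<partial>product_law N n \<partial>N)"
    by (subst P.nn_integral_fst[symmetric]) simp_all
  also have "\<dots> = (\<integral>\<^sup>+x. ennreal (\<bar>x\<bar> ^ k) * (\<integral>\<^sup>+y. ennreal (\<bar>y\<bar> ^ k) \<partial>product_law N n) \<partial>N)"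
    by (simp add: abs_mult power_mult_distrib ennreal_mult nn_integral_cmult)
  also have "\<dots> = (\<integral>\<^sup>+x. ennreal (\<bar>x\<bar> ^ k) \<partial>N) * (\<integral>\<^sup>+x. ennreal (\<bar>x\<bar> ^ k) \<partial>N) ^ n"
    by (simp add: nn_integral_multc Suc.IH)
  finally show ?case by simp
qed

text \<open>Normalise the reflected measure to a probability law \<open>N\<close> with absolute moments \<open>t k / t 0\<close>. Weighting
\<open>product_law N n\<close> by \<open>c n (t 0)\<^sup>n\<close> and summing over \<open>n\<close> yields a measure with absolute moments
\<open>\<Sum>c n (t k)\<^sup>n = g k\<close>. The sum of measures is formed by binding the kernel \<open>product_law N\<close> to a
weighted counting measure; its image under \<open>x \<mapsto> -\<bar>x\<bar>\<close> lies in \<open>(-\<infinity>, 0]\<close> and has the signs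
\<open>(-1)\<^sup>k\<close>.\<close>

lemma power_series_of_abs_moments:
  assumes "admissible_measure \<mu>" and t0: "(\<integral>x. \<bar>x\<bar> ^ 0 \<partial>\<mu>) > 0"
    and c: "\<And>n. 0 \<le> c n" and sums: "\<And>k. (\<lambda>n. c n * (\<integral>x. \<bar>x\<bar> ^ k \<partial>\<mu>) ^ n) sums g k"
  shows "(\<lambda>k. (- 1) ^ k * g k) \<in> moment_sequences {..0}"
proof -
  have [measurable_cong]: "sets \<mu> = sets borel"
    using assms(1) by (simp add: admissible_measure_def)
  define t where "t k = (\<integral>x. \<bar>x\<bar> ^ k \<partial>\<mu>)" for k
  have t_nonneg: "0 \<le> t k" for k by (simp add: t_def)
  have "t 0 > 0" using t0 by (simp add: t_def)
  have nn_t: "(\<integral>\<^sup>+x. ennreal (\<bar>x\<bar> ^ k) \<partial>\<mu>) = ennreal (t k)" for k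
    unfolding t_def
  proof (rule nn_integral_eq_integral)
    have "integrable \<mu> (\<lambda>x. \<bar>x ^ k\<bar>)"
      using assms(1) by (intro integrable_abs) (simp add: admissible_measure_def)
    then show "integrable \<mu> (\<lambda>x. \<bar>x\<bar> ^ k)" by (simp add: power_abs)
  qed simp
  define N where "N = density \<mu> (\<lambda>_. ennreal (1 / t 0))"
  have N_sets [measurable_cong]: "sets N = sets borel" by (simp add: N_def \<open>sets \<mu> = sets borel\<close>)
  have nn_N: "(\<integral>\<^sup>+x. ennreal (\<bar>x\<bar> ^ k) \<partial>N) = ennreal (t k / t 0)" for k
  proof -
    have "(\<integral>\<^sup>+x. ennreal (\<bar>x\<bar> ^ k) \<partial>N) = (\<integral>\<^sup>+x. ennreal (1 / t 0) * ennreal (\<bar>x\<bar> ^ k) \<partial>\<mu>)"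
      unfolding N_def by (rule nn_integral_density) measurable
    also have "\<dots> = ennreal (1 / t 0) * ennreal (t k)"
      unfolding nn_t[symmetric] by (rule nn_integral_cmult) measurable
    finally show ?thesis using \<open>t 0 > 0\<close> t_nonneg[of k] by (simp flip: ennreal_mult)
  qed
  have "prob_space N"
  proof (rule prob_spaceI)
    show "emeasure N (space N) = 1" using nn_N[of 0] \<open>t 0 > 0\<close> by simp
  qed
  define S where "S = density (count_space UNIV) (\<lambda>n. ennreal (c n * t 0 ^ n)) \<bind> product_law N"
  have kernel: "product_law N \<in> density (count_space UNIV) (\<lambda>n. ennreal (c n * t 0 ^ n)) \<rightarrow>\<^sub>M subprob_algebra borel"
    using product_law_prob[OF \<open>prob_space N\<close> N_sets]
    by (auto simp: space_subprob_algebra prob_space_imp_subprob_space)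
  have S_sets [measurable_cong]: "sets S = sets borel"
    unfolding S_def using product_law_prob[OF \<open>prob_space N\<close> N_sets] by (intro sets_bind) auto
  have g_nonneg: "0 \<le> g k" for k
    using sums_le[OF _ sums_zero sums[of k]] c t_nonneg[of k] by (simp add: t_def)
  have nn_S: "(\<integral>\<^sup>+x. ennreal (\<bar>x\<bar> ^ k) \<partial>S) = ennreal (g k)" for k
  proof -
    have "(\<integral>\<^sup>+x. ennreal (\<bar>x\<bar> ^ k) \<partial>S)
        = (\<integral>\<^sup>+n. ennreal (t k / t 0) ^ n \<partial>density (count_space UNIV) (\<lambda>n. ennreal (c n * t 0 ^ n)))"
      unfolding S_def
      by (subst nn_integral_bind[OF _ kernel])
         (simp_all add: product_law_abs_moment[OF \<open>prob_space N\<close> N_sets] nn_N)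
    also have "\<dots> = (\<Sum>n. ennreal (c n * t 0 ^ n) * ennreal (t k / t 0) ^ n)"
      by (simp add: nn_integral_density nn_integral_count_space_nat)
    also have "\<dots> = (\<Sum>n. ennreal (c n * t k ^ n))"
      using c t_nonneg \<open>t 0 > 0\<close>
      by (simp add: ennreal_power power_divide flip: ennreal_mult)
    also have "\<dots> = ennreal (g k)"
      using c t_nonneg sums[of k] by (intro suminf_ennreal_eq) (auto simp: t_def)
    finally show ?thesis .
  qed
  define \<sigma> where "\<sigma> = distr S borel (\<lambda>x. - \<bar>x\<bar>)"
  have abs_int: "integrable S (\<lambda>x. \<bar>x\<bar> ^ k)" for k
    by (rule integrableI_bounded) (simp_all add: power_abs nn_S)
  have refl: "(- \<bar>x\<bar>) ^ k = (- 1) ^ k * \<bar>x\<bar> ^ k" for x :: real and k by (rule power_minus)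
  have "moment \<sigma> = (\<lambda>k. (- 1) ^ k * g k)"
  proof
    fix k
    have "(\<integral>x. \<bar>x\<bar> ^ k \<partial>S) = g k"
      by (subst integral_eq_nn_integral) (simp_all add: nn_S g_nonneg)
    then show "moment \<sigma> k = (- 1) ^ k * g k"
      by (simp add: moment_def \<sigma>_def integral_distr refl)
  qed
  moreover have "admissible_measure \<sigma>"
    by (simp add: admissible_measure_def \<sigma>_def integrable_distr_eq refl abs_int)
  moreover have "AE x in \<sigma>. x \<in> {..0}"
    unfolding \<sigma>_def by (subst AE_distr_iff) auto
  ultimately show ?thesis
    unfolding moment_sequences_def mem_Collect_eq by (intro exI[of _ \<sigma>] conjI) simp_all
qed

lemma absolutely_monotonic_entire_power_series:
  assumes "absolutely_monotonic_entire G"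
  obtains c where "\<And>n. 0 \<le> c n" "\<And>x. (\<lambda>n. c n * x ^ n) sums Re (G (complex_of_real x))"
proof (rule that)
  define c where "c n = Re ((deriv ^^ n) G 0 / fact n)" for n
  have coeff: "(deriv ^^ n) G 0 / fact n \<in> \<real>\<^sub>\<ge>\<^sub>0" for n
    using assms by (simp add: absolutely_monotonic_entire_def)
  then show "0 \<le> c n" for n
    by (simp add: c_def complex_nonneg_Reals_iff)
  have c: "(deriv ^^ n) G 0 / fact n = complex_of_real (c n)" for n
    using coeff[of n] by (simp only: c_def complex_nonneg_Reals_iff complex_eq_iff) simp
  fix x
  have "(\<lambda>n. (deriv ^^ n) G 0 / fact n * (complex_of_real x - 0) ^ n) sums G (of_real x)"
    using assms by (intro holomorphic_power_series[of _ _ "\<bar>x\<bar> + 1"])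
      (auto simp: absolutely_monotonic_entire_def intro: holomorphic_on_subset)
  then have "(\<lambda>n. complex_of_real (c n * x ^ n)) sums G (of_real x)"
    unfolding c by simp
  from sums_Re[OF this] show "(\<lambda>n. c n * x ^ n) sums Re (G (of_real x))" by simp
qed

text \<open>If some \<open>t j\<close> with \<open>j > 0\<close> vanishes, then \<open>\<mu>\<close> is a multiple of the Dirac measure at 0 and all \<open>t k\<close> with
\<open>k > 0\<close> vanish; there \<open>F 0 = 0\<close> and the value \<open>G 0\<close> may differ, so the power series cannot be used
and \<open>F (t 0)\<close> times the Dirac measure at 0 represents the transform. Otherwise all \<open>t k\<close> are positive
and \<open>F\<close> agrees with \<open>G\<close> at them.\<close>

lemma preserver_if_absolutely_monotonic:
  fixes F :: "real \<Rightarrow> real"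
  assumes G: "absolutely_monotonic_entire G"
    and F: "\<And>x. x > 0 \<Longrightarrow> F x = Re (G (complex_of_real x))"
      "F 0 = 0" "\<And>x. x \<ge> 0 \<Longrightarrow> F (- x) = - F x"
    and s: "s \<in> moment_sequences {-1..0}"
  shows "entrywise F s \<in> moment_sequences {..0}"
proof -
  obtain \<mu> where \<mu>: "admissible_measure \<mu>" "AE x in \<mu>. x \<in> {-1..0}" "s = moment \<mu>"
    using s by (auto simp: moment_sequences_def)
  obtain c where c: "\<And>n. 0 \<le> c n" "\<And>x. (\<lambda>n. c n * x ^ n) sums Re (G (complex_of_real x))"
    using absolutely_monotonic_entire_power_series[OF G] by blast
  have [measurable_cong]: "sets \<mu> = sets borel"
    using \<mu>(1) by (simp add: admissible_measure_def)
  define t where "t k = (\<integral>x. \<bar>x\<bar> ^ k \<partial>\<mu>)" for k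
  have t_nonneg: "0 \<le> t k" for k by (simp add: t_def)
  have int: "integrable \<mu> (\<lambda>x. \<bar>x\<bar> ^ k)" for k
  proof -
    have "integrable \<mu> (\<lambda>x. \<bar>x ^ k\<bar>)"
      using \<mu>(1) by (intro integrable_abs) (simp add: admissible_measure_def)
    then show ?thesis by (simp add: power_abs)
  qed
  have s_t: "s k = (- 1) ^ k * t k" for k
  proof -
    have "s k = (\<integral>x. (- 1) ^ k * \<bar>x\<bar> ^ k \<partial>\<mu>)"
      unfolding \<mu>(3) moment_def
    proof (rule integral_cong_AE)
      show "AE x in \<mu>. x ^ k = (- 1) ^ k * \<bar>x\<bar> ^ k"
        using \<mu>(2) by eventually_elim (simp add: power_mult_distrib[symmetric])
    qed measurable
    then show ?thesis by (simp add: t_def)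
  qed
  have F_s: "F (s k) = (- 1) ^ k * F (t k)" for k
    using t_nonneg[of k] F(3) by (cases "even k") (simp_all add: s_t)
  show ?thesis
  proof (cases "\<exists>j>0. t j = 0")
    case True
    then obtain j where j: "j > 0" "t j = 0" by blast
    have "AE x in \<mu>. \<bar>x\<bar> ^ j = 0"
      using j(2) integral_nonneg_eq_0_iff_AE[OF int[of j]] by (simp add: t_def)
    then have null: "AE x in \<mu>. x = 0" by eventually_elim (use j(1) in simp)
    have t_zero: "t k = 0" if "k > 0" for k
    proof -
      have "t k = (\<integral>x. 0 \<partial>\<mu>)"
        unfolding t_def
      proof (rule integral_cong_AE)
        show "AE x in \<mu>. \<bar>x\<bar> ^ k = 0"
          using null by eventually_elim (use that in simp)
      qed measurable
      then show ?thesis by simp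
    qed
    have "0 \<le> Re (G (complex_of_real x))" if "x \<ge> 0" for x
      using sums_le[OF _ sums_zero c(2)[of x]] c(1) that by simp
    then have "0 \<le> F (t 0)" using F(1,2) t_nonneg[of 0] by (cases "t 0 = 0") auto
    then have "(\<lambda>k. (- 1) ^ k * (0 + F (t 0) * 0 ^ k)) \<in> moment_sequences {-1..0}"
      by (intro two_point_moments) auto
    also have "(\<lambda>k. (- 1) ^ k * (0 + F (t 0) * 0 ^ k)) = entrywise F s"
      using t_zero F(2) by (auto simp: entrywise_def F_s power_0_left)
    finally show ?thesis
      by (rule subsetD[OF moment_sequences_mono, rotated]) simp
  next
    case False
    have t_pos: "t k > 0" if "k > 0" for k
      using t_nonneg[of k] False that by (metis order_le_less)
    have "t 0 > 0"
    proof (rule ccontr)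
      assume "\<not> t 0 > 0"
      then have "t 0 = 0" using t_nonneg[of 0] by simp
      then have "AE x in \<mu>. \<bar>x\<bar> ^ 0 = (0 :: real)"
        using integral_nonneg_eq_0_iff_AE[OF int[of 0]] by (simp add: t_def)
      then have "t 1 = (\<integral>x. 0 \<partial>\<mu>)"
        unfolding t_def by (intro integral_cong_AE) auto
      then show False using t_pos[of 1] by simp
    qed
    then have pos: "t k > 0" for k using t_pos by (cases "k = 0") auto
    have "(\<lambda>k. (- 1) ^ k * Re (G (complex_of_real (t k)))) \<in> moment_sequences {..0}"
      using \<open>t 0 > 0\<close> c by (intro power_series_of_abs_moments[OF \<mu>(1)]) (simp_all only: t_def)
    also have "(\<lambda>k. (- 1) ^ k * Re (G (complex_of_real (t k)))) = entrywise F s"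
      using pos by (auto simp: entrywise_def F_s F(1))
    finally show ?thesis .
  qed
qed

theorem theorem3p4:
  fixes F :: "real \<Rightarrow> real"
  shows "(\<forall>s \<in> moment_sequences {-1..0}. entrywise F s \<in> moment_sequences {..0}) \<longleftrightarrow>
    (\<exists>G. absolutely_monotonic_entire G \<and>
      (\<forall>x. complex_of_real (F x) =
        (if x > 0 then G (complex_of_real x)
         else if x = 0 then 0
         else - G (complex_of_real (- x)))))"
  (is "?preserves \<longleftrightarrow> ?odd_extension")
proof
  assume preserves: ?preserves
  obtain G where G: "absolutely_monotonic_entire G"
    "\<And>x. x > 0 \<Longrightarrow> G (complex_of_real x) = complex_of_real (F x)"
    using absolutely_monotonic_if_preserver[OF preserves] by blast
  have odd: "F (- x) = - F x" if "x \<ge> 0" for x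
    using preserver_geometric_moments(2)[OF preserves that] .
  show ?odd_extension
  proof (intro exI[of _ G] conjI allI)
    fix x
    show "complex_of_real (F x) =
        (if x > 0 then G (complex_of_real x)
         else if x = 0 then 0
         else - G (complex_of_real (- x)))"
      using G(2)[of x] G(2)[of "- x"] odd[of "- x"] preserver_geometric_moments(1)[OF preserves]
      by (cases x "0 :: real" rule: linorder_cases) simp_all
  qed (rule G(1))
next
  assume ?odd_extension
  then obtain G where G: "absolutely_monotonic_entire G"
    and F: "\<And>x. complex_of_real (F x) =
        (if x > 0 then G (complex_of_real x)
         else if x = 0 then 0
         else - G (complex_of_real (- x)))"
    by blast
  have pos: "F x = Re (G (complex_of_real x))" if "x > 0" for x
    using arg_cong[OF F[of x], of Re] that by simp
  have zero: "F 0 = 0"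
    using F[of 0] by simp
  have "F (- x) = - F x" if "x \<ge> 0" for x
  proof (cases "x = 0")
    case False
    then show ?thesis
      using arg_cong[OF F[of "- x"], of Re] pos[of x] that by simp
  qed (simp add: zero)
  then show ?preserves
    using preserver_if_absolutely_monotonic[OF G pos zero] by blast
qed

end
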